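(* For every fixed $r>0$, the function $s \mapsto \theta_o(rs)\,\theta_o(r/s)$, $s>0$, attains its maximum at $s=1$.
   Context: For $s>0$, $\theta_o(s) = \sum_{k\in\mathbb{Z}} e^{-\pi (2k+1)^2 s}$. *)

theory Defs
  imports "HOL-Analysis.Analysis"
begin

definition theta_o :: "real \<Rightarrow> real" where
  "theta_o s = (\<Sum>\<^sub>\<infinity>k::int. exp (- pi * (2 * of_int k + 1)^2 * s))"

end

theory Submission
  imports Defs "HOL-Real_Asymp.Real_Asymp"
begin

text \<open>
  The functional equation of the theta function gives
  \<open>2 \<surd>s \<theta>\<^sub>o(s) = 1 + 2 \<Sum>\<^sub>j (-1)\<^sup>j q\<^bsup>j\<^sup>2\<^esup>\<close> with \<open>q = e\<^bsup>-\<pi>/(4s)\<^esup>\<close>, and by Gauss's identity the right-hand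
  side is \<open>\<Prod>\<^sub>k (1 - q\<^sup>k)/(1 + q\<^sup>k) = \<Prod>\<^sub>k tanh (k\<pi>/(8s))\<close>. The inequality therefore holds factor by
  factor, because \<open>tanh a tanh b \<le> tanh\<^sup>2 \<surd>(ab)\<close>. The latter amounts to
  \<open>cosh \<surd>(u\<^sup>2 + v\<^sup>2) \<le> cosh u cosh v\<close>, which is visible on the power series.

  The functional equation is obtained by Polya's method: the sum of the binomial coefficients
  \<open>C(2m, m + k)\<close> over the odd multiples \<open>k\<close> of \<open>l\<close> is an alternating sum of powers
  \<open>cos\<^bsup>2m\<^esup> (\<pi>j/(2l))\<close>, and both sides converge to theta series when \<open>l \<rightarrow> \<infinity>\<close> with
  \<open>m/l\<^sup>2 \<rightarrow> 1/(\<pi>s)\<close>.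
\<close>

subsection \<open>The hyperbolic tangent and geometric means\<close>

text \<open>Midpoint convexity of the \<open>n\<close>-th power at \<open>A + B\<close> and
  \<open>A - B\<close>. The hypothesis keeps both points nonnegative, where odd powers are convex
  too.\<close>

lemma two_power_le_sum_conjugate_powers:
  fixes A B :: real
  assumes "\<bar>B\<bar> \<le> A"
  shows "2 * A ^ n \<le> (A + B) ^ n + (A - B) ^ n"
proof -
  have "convex_on {0..} (\<lambda>x::real. x ^ n)"
  proof (cases "even n")
    case True
    then show ?thesis
      using convex_on_subset[OF convex_power_even, of n "{0..}"] by (simp add: convex_real_interval)
  qed (simp add: convex_power_odd)
  from convex_onD[OF this, of "1/2" "A + B" "A - B"] assms
  show ?thesis by (simp add: field_simps)
qed

text \<open>Arranged in powers of \<open>x\<^sup>2\<close>, because the next comparison knows its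
  arguments only through their squares.\<close>

lemma cosh_even_series: "(\<lambda>n. (x\<^sup>2) ^ n / fact (2 * n)) sums cosh (x::real)"
proof -
  have "strict_mono (\<lambda>n::nat. 2 * n)" by (simp add: strict_mono_def)
  from sums_mono_reindex[OF this, of "\<lambda>n. if even n then x ^ n /\<^sub>R fact n else 0" "cosh x"]
  have "(\<lambda>n. (x ^ (2 * n)) /\<^sub>R fact (2 * n)) sums cosh x"
    using cosh_converges[of x] by (simp add: image_iff) (metis evenE)
  then show ?thesis
    by (simp add: power_mult divide_inverse_commute)
qed

text \<open>Twice the right-hand side is \<open>cosh (u + v) + cosh (u - v)\<close>, and the squares
  of these arguments are \<open>w\<^sup>2 + 2 * u * v\<close> and
  \<open>w\<^sup>2 - 2 * u * v\<close>. The series therefore compare term by term, by convexity of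
  powers.\<close>

lemma cosh_le_cosh_mult_cosh:
  fixes u v w :: real
  assumes w: "w\<^sup>2 = u\<^sup>2 + v\<^sup>2"
  shows "cosh w \<le> cosh u * cosh v"
proof -
  have series: "(\<lambda>n. ((u + v)\<^sup>2) ^ n / fact (2 * n) + ((u - v)\<^sup>2) ^ n / fact (2 * n))
          sums (cosh (u + v) + cosh (u - v))"
    by (intro sums_add cosh_even_series)
  have series_w: "(\<lambda>n. 2 * ((w\<^sup>2) ^ n / fact (2 * n))) sums (2 * cosh w)"
    by (intro sums_mult cosh_even_series)
  have "2 * ((w\<^sup>2) ^ n / fact (2 * n))
      \<le> ((u + v)\<^sup>2) ^ n / fact (2 * n) + ((u - v)\<^sup>2) ^ n / fact (2 * n)" for n
  proof -
    have "\<bar>2 * u * v\<bar> \<le> w\<^sup>2"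
      unfolding w using sum_squares_bound[of u v] sum_squares_bound[of u "-v"] by (simp add: abs_le_iff)
    from two_power_le_sum_conjugate_powers[OF this, of n]
    have "2 * (w\<^sup>2) ^ n \<le> ((u + v)\<^sup>2) ^ n + ((u - v)\<^sup>2) ^ n"
      by (simp add: w power2_sum power2_diff)
    then have "(2 * (w\<^sup>2) ^ n) / fact (2 * n) \<le> (((u + v)\<^sup>2) ^ n + ((u - v)\<^sup>2) ^ n) / fact (2 * n)"
      by (rule divide_right_mono) simp
    then show ?thesis by (simp add: add_divide_distrib)
  qed
  then have "2 * cosh w \<le> cosh (u + v) + cosh (u - v)"
    by (rule sums_le[OF _ series_w series])
  then show ?thesis by (simp add: cosh_add cosh_diff)
qed

text \<open>The previous inequality is applied to \<open>w = a + b\<close>,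
  \<open>u = a - b\<close>, \<open>v = 2 * c\<close>. The addition theorems and
  \<open>cosh (2 * c) = 1 + 2 * (sinh c)\<^sup>2\<close> turn it into the claim with denominators
  cleared.\<close>

lemma tanh_mult_le_tanh_geometric_mean:
  fixes a b c :: real
  assumes c: "c\<^sup>2 = a * b"
  shows "tanh a * tanh b \<le> (tanh c)\<^sup>2"
proof -
  have "(a + b)\<^sup>2 = (a - b)\<^sup>2 + (2 * c)\<^sup>2"
    by (simp add: power_mult_distrib c) (simp add: power2_eq_square algebra_simps)
  from cosh_le_cosh_mult_cosh[OF this]
  have "cosh (a + b) \<le> cosh (a - b) * (1 + 2 * (sinh c)\<^sup>2)"
    by (simp add: cosh_double cosh_square_eq add.commute)
  then have "sinh a * sinh b \<le> (cosh a * cosh b - sinh a * sinh b) * (sinh c)\<^sup>2"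
    by (simp add: cosh_add cosh_diff algebra_simps)
  then have "(sinh a * sinh b) * (cosh c)\<^sup>2 \<le> (sinh c)\<^sup>2 * (cosh a * cosh b)"
    by (simp add: cosh_square_eq algebra_simps)
  then show ?thesis
    by (simp add: tanh_def power_divide divide_simps mult_ac)
qed

subsection \<open>Gauss's product for the alternating theta series\<close>

text \<open>
  A finite form of Gauss's identity in the manner of Shanks: for fixed \<open>n\<close> these terms sum to
  the partial sum of the alternating theta series, the term \<open>s = 0\<close> is the partial product
  (the factor 2 cancels against \<open>1 + q ^ 0\<close>), and all others are \<open>O(q ^ n)\<close>.
\<close>

definition gauss_remainder :: "real \<Rightarrow> nat \<Rightarrow> nat \<Rightarrow> real" where
  "gauss_remainder q n s =
     (-1) ^ s * 2 * q ^ (s * (n + 1)) * (\<Prod>k=Suc s..n. 1 - q ^ k) / (\<Prod>k=s..n. 1 + q ^ k)"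

text \<open>Raising \<open>n\<close> contributes \<open>q ^ s\<close> from the power and one new top
  factor to each product.\<close>

lemma gauss_remainder_Suc_left:
  assumes "s \<le> n" "0 \<le> q"
  shows "gauss_remainder q (Suc n) s * (1 + q ^ Suc n) =
         gauss_remainder q n s * q ^ s * (1 - q ^ Suc n)"
proof -
  have "1 + q ^ k > 0" for k using assms by (simp add: add_pos_nonneg)
  then have [simp]: "1 + q ^ k \<noteq> 0" "1 + q * q ^ k \<noteq> 0" for k
    by (metis less_irrefl) (metis less_irrefl power_Suc \<open>\<And>k. 1 + q ^ k > 0\<close>)
  have "(\<Prod>k=s..n. 1 + q ^ k) \<noteq> 0" by simp
  then show ?thesis using assms(1)
    by (simp add: gauss_remainder_def prod.nat_ivl_Suc' divide_simps power_add)
qed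

text \<open>Raising \<open>s\<close> flips the sign, multiplies the power by
  \<open>q ^ Suc n\<close> and removes the lowest factor of each product. The removed numerator
  factor stays on the left because it may vanish.\<close>

lemma gauss_remainder_Suc_right:
  assumes "s < n" "0 \<le> q"
  shows "gauss_remainder q n (Suc s) * (1 - q ^ Suc s) =
         - gauss_remainder q n s * q ^ Suc n * (1 + q ^ s)"
proof -
  have "1 + q ^ k > 0" for k using assms by (simp add: add_pos_nonneg)
  then have nz: "1 + q ^ k \<noteq> 0" for k by (metis less_irrefl)
  then have 1: "(\<Prod>k=Suc s..n. 1 + q ^ k) \<noteq> 0" by simp
  have 2: "(\<Prod>k=s..n. 1 + q ^ k) = (1 + q ^ s) * (\<Prod>k=Suc s..n. 1 + q ^ k)"
    using assms by (simp add: prod.atLeast_Suc_atMost)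
  have 3: "(\<Prod>k=Suc s..n. 1 - q ^ k) = (1 - q ^ Suc s) * (\<Prod>k=Suc (Suc s)..n. 1 - q ^ k)"
    using assms by (subst prod.atLeast_Suc_atMost) auto
  have 4: "q ^ (Suc s * (n + 1)) = q ^ (s * (n + 1)) * q ^ Suc n"
    by (simp add: power_add mult_ac)
  have "a * E * M / Q * N = a * (E / ((1 + q ^ s) * Q)) * (N * M) * (1 + q ^ s)"
    if "Q \<noteq> 0" for a E M N Q :: real
    using that nz[of s] by (simp add: divide_simps)
  from this[OF 1] show ?thesis
    unfolding gauss_remainder_def 2 3 4 by (simp add: mult_ac)
qed

text \<open>Induction on \<open>n\<close>: the change of the terms is a difference in
  \<open>s\<close>, so its sum telescopes. Only the boundary value \<open>U n\<close> and the new
  term \<open>s = Suc n\<close> survive, and together they form the next term of the theta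
  series.\<close>

lemma sum_gauss_remainder:
  assumes "0 \<le> q" "q < 1"
  shows "(\<Sum>s\<le>n. gauss_remainder q n s) = 1 + 2 * (\<Sum>j=1..n. (-1) ^ j * q ^ (j\<^sup>2))"
proof (induction n)
  case 0
  show ?case by (simp add: gauss_remainder_def)
next
  case (Suc n)
  define D where "D = 1 + q ^ Suc n"
  have D: "D > 0" unfolding D_def using assms by (simp add: add_pos_nonneg)
  \<comment> \<open>This is the telescoping certificate. For \<open>s < n\<close> the second
    recurrence rewrites it as
    \<open>- gauss_remainder q n (Suc s) * (1 - q ^ Suc s) / D\<close>.\<close>
  define U where "U s = gauss_remainder q n s * q ^ Suc n * (1 + q ^ s) / D" for s
  have step: "gauss_remainder q (Suc n) s - gauss_remainder q n s
      = (if s = 0 then 0 else U (s - 1)) - U s" if "s \<le> n" for s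
  proof -
    have "(gauss_remainder q (Suc n) s - gauss_remainder q n s) * D
        = - (gauss_remainder q n s * (1 - q ^ s)) - U s * D"
    proof -
      have U: "U s * D = gauss_remainder q n s * q ^ Suc n * (1 + q ^ s)"
        using D by (simp add: U_def)
      have G: "gauss_remainder q (Suc n) s * D = gauss_remainder q n s * q ^ s * (1 - q ^ Suc n)"
        unfolding D_def by (rule gauss_remainder_Suc_left[OF that assms(1)])
      show ?thesis unfolding left_diff_distrib U G by (simp add: D_def algebra_simps)
    qed
    also have "gauss_remainder q n s * (1 - q ^ s) = - (if s = 0 then 0 else U (s - 1)) * D"
    proof (cases s)
      case (Suc t)
      then show ?thesis
        using gauss_remainder_Suc_right[of t n q] that assms D by (simp add: U_def)
    qed simp
    finally have "(gauss_remainder q (Suc n) s - gauss_remainder q n s) * D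
        = ((if s = 0 then 0 else U (s - 1)) - U s) * D"
      by (simp only: left_diff_distrib mult_minus_left minus_minus)
    then show ?thesis using D by simp
  qed
  have tele: "(\<Sum>s\<le>N. (if s = 0 then 0 else U (s - 1)) - U s) = - U N" for N
    by (induction N) auto
  have U_last: "U n * D = (-1) ^ n * 2 * q ^ ((Suc n)\<^sup>2)"
  proof -
    have "1 + q ^ n > 0" using assms by (simp add: add_pos_nonneg)
    moreover have "q ^ ((Suc n)\<^sup>2) = q ^ (n * (n + 1)) * q ^ Suc n"
    proof -
      have "(Suc n)\<^sup>2 = n * (n + 1) + Suc n" by (simp add: power2_eq_square)
      then show ?thesis by (simp only: power_add)
    qed
    ultimately show ?thesis
      using D by (simp add: U_def gauss_remainder_def)
  qed
  have "(\<Sum>s\<le>Suc n. gauss_remainder q (Suc n) s)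
      = (\<Sum>s\<le>n. gauss_remainder q n s) + (\<Sum>s\<le>n. gauss_remainder q (Suc n) s - gauss_remainder q n s)
        + gauss_remainder q (Suc n) (Suc n)"
    by (simp add: sum_subtractf)
  also have "(\<Sum>s\<le>n. gauss_remainder q (Suc n) s - gauss_remainder q n s) = - U n"
    using step tele[of n] by simp
  \<comment> \<open>After multiplication by \<open>D\<close>, the new term supplies the theta term
    \<open>D - 1\<close> times and \<open>- U n\<close> supplies it once, so that \<open>D\<close>
    cancels.\<close>
  also have "gauss_remainder q (Suc n) (Suc n) - U n = 2 * (-1) ^ Suc n * q ^ ((Suc n)\<^sup>2)"
  proof -
    have "gauss_remainder q (Suc n) (Suc n) * D = 2 * (-1) ^ Suc n * q ^ (Suc n * (Suc n + 1))"
      using D by (simp add: gauss_remainder_def D_def)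
    also have "q ^ (Suc n * (Suc n + 1)) = q ^ ((Suc n)\<^sup>2) * (D - 1)"
    proof -
      have "Suc n * (Suc n + 1) = (Suc n)\<^sup>2 + Suc n" by (simp add: power2_eq_square)
      then show ?thesis by (simp only: D_def power_add add_diff_cancel_left')
    qed
    finally have "(gauss_remainder q (Suc n) (Suc n) - U n) * D = (2 * (-1) ^ Suc n * q ^ ((Suc n)\<^sup>2)) * D"
      using U_last by (simp add: algebra_simps)
    then show ?thesis using D by (metis mult_right_cancel less_irrefl)
  qed
  then have "(\<Sum>s\<le>n. gauss_remainder q n s) + - U n + gauss_remainder q (Suc n) (Suc n)
     = (\<Sum>s\<le>n. gauss_remainder q n s) + 2 * (-1) ^ Suc n * q ^ ((Suc n)\<^sup>2)"
    by linarith
  finally show ?case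
    unfolding Suc.IH by (simp add: algebra_simps)
qed

text \<open>The numerator product lies in \<open>{0..1}\<close>, the denominator is at least 1, and
  \<open>s \<ge> 1\<close> makes the exponent at least \<open>n + 1\<close>.\<close>

lemma abs_gauss_remainder_le:
  assumes "0 \<le> q" "q < 1" "0 < s"
  shows "\<bar>gauss_remainder q n s\<bar> \<le> 2 * q ^ Suc n"
proof -
  have "(\<Prod>k=Suc s..n. 1 - q ^ k) \<in> {0..1}"
    using assms by (auto intro!: prod_nonneg prod_le_1 simp: power_le_one)
  moreover have den: "(\<Prod>k=s..n. 1 + q ^ k) \<ge> 1"
    using assms by (intro prod_ge_1) simp
  moreover have "q ^ (s * (n + 1)) \<le> q ^ Suc n"
    using assms mult_le_mono1[of 1 s "n + 1"] by (intro power_decreasing) auto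
  ultimately have "(2 * q ^ (s * (n + 1)) * (\<Prod>k=Suc s..n. 1 - q ^ k)) / (\<Prod>k=s..n. 1 + q ^ k)
      \<le> (2 * q ^ Suc n * 1) / 1"
    using assms by (intro frac_le mult_mono) auto
  moreover have "\<bar>gauss_remainder q n s\<bar>
     = (2 * q ^ (s * (n + 1)) * (\<Prod>k=Suc s..n. 1 - q ^ k)) / (\<Prod>k=s..n. 1 + q ^ k)"
    using assms \<open>(\<Prod>k=Suc s..n. 1 - q ^ k) \<in> {0..1}\<close> den
    by (simp add: gauss_remainder_def abs_mult power_abs)
  ultimately show ?thesis by simp
qed

text \<open>The term \<open>s = 0\<close> is the product itself; the other \<open>n\<close> terms
  are each at most \<open>2 * q ^ Suc n\<close>, and \<open>n * q ^ n\<close> tends to 0.\<close>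

lemma gauss_product_minus_partial_sum_tendsto_0:
  fixes q :: real
  assumes "0 \<le> q" "q < 1"
  shows "(\<lambda>n. (\<Prod>k=1..n. (1 - q ^ k) / (1 + q ^ k)) -
              (1 + 2 * (\<Sum>j=1..n. (-1) ^ j * q ^ (j\<^sup>2)))) \<longlonglongrightarrow> 0"
proof (rule Lim_null_comparison)
  have "(\<lambda>n. real n * q ^ n) \<longlonglongrightarrow> 0"
    using assms by (intro powser_times_n_limit_0) auto
  then have "(\<lambda>n. (2 * q) * (real n * q ^ n)) \<longlonglongrightarrow> 2 * q * 0"
    by (intro tendsto_mult tendsto_const)
  then show "(\<lambda>n. 2 * q * (real n * q ^ n)) \<longlonglongrightarrow> 0" by simp
  show "\<forall>\<^sub>F n in sequentially. norm ((\<Prod>k=1..n. (1 - q ^ k) / (1 + q ^ k)) -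
              (1 + 2 * (\<Sum>j=1..n. (-1) ^ j * q ^ (j\<^sup>2)))) \<le> 2 * q * (real n * q ^ n)"
  proof (intro always_eventually allI)
    fix n
    have "gauss_remainder q n 0 = (\<Prod>k=1..n. (1 - q ^ k) / (1 + q ^ k))"
      by (simp add: gauss_remainder_def prod_dividef prod.atLeast_Suc_atMost)
    then have "1 + 2 * (\<Sum>j=1..n. (-1) ^ j * q ^ (j\<^sup>2))
        = (\<Prod>k=1..n. (1 - q ^ k) / (1 + q ^ k)) + (\<Sum>s=1..n. gauss_remainder q n s)"
      using sum_gauss_remainder[OF assms, of n]
      by (simp add: sum.atMost_shift sum.atLeast1_atMost_eq)
    moreover have "\<bar>\<Sum>s=1..n. gauss_remainder q n s\<bar> \<le> (\<Sum>s=1..n. 2 * q ^ Suc n)"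
      using assms by (intro order.trans[OF sum_abs] sum_mono abs_gauss_remainder_le) auto
    ultimately show "norm ((\<Prod>k=1..n. (1 - q ^ k) / (1 + q ^ k)) -
              (1 + 2 * (\<Sum>j=1..n. (-1) ^ j * q ^ (j\<^sup>2)))) \<le> 2 * q * (real n * q ^ n)"
      by (simp add: mult_ac)
  qed
qed

subsection \<open>The functional equation as a limit of binomial sums\<close>

lemma cos_power_even_expansion:
  "(2 * cos x) ^ (2 * m) = (\<Sum>i\<le>2 * m. real (2 * m choose i) * cos (2 * (real i - real m) * x))"
proof -
  have "complex_of_real (2 * cos x) = cis x + cis (- x)"
    by (simp add: complex_eq_iff)
  then have "complex_of_real ((2 * cos x) ^ (2 * m)) = (cis x + cis (- x)) ^ (2 * m)"
    by (metis of_real_power)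
  also have "\<dots> = (\<Sum>i\<le>2 * m. of_nat (2 * m choose i) * cis x ^ i * cis (- x) ^ (2 * m - i))"
    by (rule binomial_ring)
  also have "\<dots> = (\<Sum>i\<le>2 * m. of_nat (2 * m choose i) * cis (2 * (real i - real m) * x))"
    by (intro sum.cong refl)
      (simp add: Complex.DeMoivre mult.assoc cis_mult of_nat_diff algebra_simps)
  finally have "Re (complex_of_real ((2 * cos x) ^ (2 * m)))
      = Re (\<Sum>i\<le>2 * m. of_nat (2 * m choose i) * cis (2 * (real i - real m) * x))"
    by (rule arg_cong)
  then show ?thesis by simp
qed

text \<open>Real part of a geometric sum of powers of an \<open>N\<close>-th root of unity; it
  serves as a filter for divisibility by \<open>N\<close>.\<close>

lemma sum_cos_roots_of_unity:
  fixes d :: int and N :: nat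
  assumes "N > 0"
  shows "(\<Sum>j<N. cos (2 * pi * of_int d * real j / real N)) = (if int N dvd d then real N else 0)"
proof -
  define w where "w = cis (2 * pi * of_int d / real N)"
  have pow: "w ^ j = cis (2 * pi * of_int d * real j / real N)" for j
    by (simp add: w_def Complex.DeMoivre mult_ac)
  have "(\<Sum>j<N. cos (2 * pi * of_int d * real j / real N)) = Re (\<Sum>j<N. w ^ j)"
    by (simp add: pow)
  moreover have "(\<Sum>j<N. w ^ j) = (if int N dvd d then of_nat N else 0)"
  proof (cases "int N dvd d")
    case True
    then obtain e where "d = int N * e" by blast
    then have "2 * pi * of_int d / real N = 2 * pi * of_int e" using assms by simp
    then have "w = 1" unfolding w_def by (simp only: cis_multiple_2pi Ints_of_int)
    then show ?thesis using True by simp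
  next
    case False
    have "w \<noteq> 1"
    proof
      assume "w = 1"
      then have "cos (2 * pi * of_int d / real N) = 1" by (simp add: w_def complex_eq_iff)
      then obtain n :: int where "2 * pi * of_int d / real N = of_int n * 2 * pi"
        by (auto simp: cos_one_2pi_int)
      then have "real_of_int d = real_of_int (n * int N)"
        using assms by (simp add: field_simps)
      then have "d = n * int N" by (simp only: of_int_eq_iff)
      then show False using False by simp
    qed
    moreover have "w ^ N = 1"
      using assms by (simp add: pow cis_multiple_2pi)
    ultimately show ?thesis using False by (simp add: geometric_sum)
  qed
  ultimately show ?thesis by simp
qed

text \<open>The filter is used with \<open>N = 2 * l\<close>. The sign \<open>(-1) ^ j\<close>
  equals \<open>cos (pi * j)\<close> and shifts the frequency by \<open>l\<close>, so that exactly
  the indices with \<open>i - m\<close> an odd multiple of \<open>l\<close> are selected.\<close>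

lemma sum_alternating_cos_power_eq_sum_binomial:
  assumes l: "l > 0"
  shows "4 ^ m * (\<Sum>j<2 * l. (-1) ^ j * cos (pi * real j / (2 * real l)) ^ (2 * m))
       = 2 * real l * (\<Sum>i | i \<le> 2 * m \<and> 2 * int l dvd int i - int m + int l. real (2 * m choose i))"
proof -
  have cos_shift: "(-1) ^ j * cos (2 * (real i - real m) * (pi * real j / (2 * real l)))
      = cos (2 * pi * of_int (int i - int m + int l) * real j / real (2 * l))" for i j
  proof -
    have "2 * pi * of_int (int i - int m + int l) * real j / real (2 * l)
        = 2 * (real i - real m) * (pi * real j / (2 * real l)) + pi * real j"
      using l by (simp add: field_simps)
    then show ?thesis by (simp add: cos_add mult.commute[of pi])
  qed
  have "4 ^ m * (\<Sum>j<2 * l. (-1) ^ j * cos (pi * real j / (2 * real l)) ^ (2 * m))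
      = (\<Sum>j<2 * l. (-1) ^ j * (2 * cos (pi * real j / (2 * real l))) ^ (2 * m))"
  proof -
    have "(4::real) ^ m = 2 ^ (2 * m)" by (simp add: power_mult)
    then show ?thesis by (simp only: sum_distrib_left power_mult_distrib mult_ac)
  qed
  also have "\<dots> = (\<Sum>j<2 * l. \<Sum>i\<le>2 * m. real (2 * m choose i) *
      cos (2 * pi * of_int (int i - int m + int l) * real j / real (2 * l)))"
    unfolding cos_power_even_expansion sum_distrib_left
    by (intro sum.cong refl) (simp only: cos_shift[symmetric] mult.left_commute)
  also have "\<dots> = (\<Sum>i\<le>2 * m. real (2 * m choose i) *
      (if int (2 * l) dvd int i - int m + int l then real (2 * l) else 0))"
    using l by (subst sum.swap) (simp only: sum_cos_roots_of_unity flip: sum_distrib_left)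
  also have "\<dots> = (\<Sum>i\<le>2 * m. if 2 * int l dvd int i - int m + int l
      then 2 * real l * real (2 * m choose i) else 0)"
    by (intro sum.cong) auto
  also have "\<dots> = 2 * real l * (\<Sum>i | i \<le> 2 * m \<and> 2 * int l dvd int i - int m + int l. real (2 * m choose i))"
    by (simp add: sum.If_cases sum_distrib_left Int_def)
  finally show ?thesis .
qed

text \<open>The reflection of \<open>i\<close> to \<open>2 * m - i\<close> exchanges the indices
  below and above \<open>m\<close>, and \<open>m\<close> itself is not selected because 0 is not an
  odd multiple of \<open>l\<close>.\<close>

lemma sum_binomial_odd_multiples:
  assumes l: "l > 0"
  shows "(\<Sum>i | i \<le> 2 * m \<and> 2 * int l dvd int i - int m + int l. real (2 * m choose i))
       = 2 * (\<Sum>n<m. real (2 * m choose (m + (2 * n + 1) * l)))"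
proof -
  define S where "S = {i. i \<le> 2 * m \<and> 2 * int l dvd int i - int m + int l}"
  have fin: "finite S" unfolding S_def by simp
  have "m \<notin> S" using l by (auto simp: S_def dest!: zdvd_imp_le)
  then have S: "S = {i \<in> S. m < i} \<union> {i \<in> S. i < m}" by (auto simp: not_less order.order_iff_strict)
  have "sum (\<lambda>i. real (2 * m choose i)) S
      = (\<Sum>i | i \<in> S \<and> m < i. real (2 * m choose i)) + (\<Sum>i | i \<in> S \<and> i < m. real (2 * m choose i))"
    using fin by (subst S, subst sum.union_disjoint) auto
  also have "(\<Sum>i | i \<in> S \<and> i < m. real (2 * m choose i)) = (\<Sum>i | i \<in> S \<and> m < i. real (2 * m choose i))"
  proof (rule sum.reindex_bij_witness[of _ "\<lambda>i. 2 * m - i" "\<lambda>i. 2 * m - i"])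
    have refl: "2 * int l dvd int (2 * m - i) - int m + int l"
      if "i \<le> 2 * m" "2 * int l dvd int i - int m + int l" for i
    proof -
      have "int (2 * m - i) - int m + int l = 2 * int l - (int i - int m + int l)"
        using that by (simp add: of_nat_diff)
      then show ?thesis using that by (metis dvd_diff dvd_refl)
    qed
    show "2 * m - i \<in> {i. i \<in> S \<and> m < i}" if "i \<in> {i. i \<in> S \<and> i < m}" for i
      using that refl[of i] by (auto simp: S_def)
    show "2 * m - i \<in> {i. i \<in> S \<and> i < m}" if "i \<in> {i. i \<in> S \<and> m < i}" for i
      using that refl[of i] by (auto simp: S_def)
  qed (auto simp: S_def binomial_symmetric[symmetric])
  also have "(\<Sum>i | i \<in> S \<and> m < i. real (2 * m choose i))
      = (\<Sum>i\<in>(\<lambda>n. m + (2 * n + 1) * l) ` {..<m}. real (2 * m choose i))"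
  \<comment> \<open>The range \<open>n < m\<close> may be too long, but every surplus index exceeds
    \<open>2 * m\<close> and has binomial coefficient 0.\<close>
  proof (rule sum.mono_neutral_left)
    show "{i. i \<in> S \<and> m < i} \<subseteq> (\<lambda>n. m + (2 * n + 1) * l) ` {..<m}"
    proof
      fix i assume i: "i \<in> {i. i \<in> S \<and> m < i}"
      then obtain e where e: "int i - int m + int l = 2 * int l * e" by (auto simp: S_def)
      have "2 * int l * e > 0" using i unfolding e[symmetric] by auto
      then have "e > 0" using l by (simp add: zero_less_mult_iff)
      define n where "n = nat (e - 1)"
      have n: "e = int n + 1" using \<open>e > 0\<close> by (simp add: n_def)
      have "int i = int (m + (2 * n + 1) * l)"
        using e unfolding n by (simp add: algebra_simps)
      then have i_eq: "i = m + (2 * n + 1) * l" by linarith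
      have "m + (2 * n + 1) \<le> m + (2 * n + 1) * l"
        using l mult_le_mono2[of 1 l "2 * n + 1"] by (intro add_left_mono) simp
      also have "\<dots> \<le> 2 * m" using i unfolding i_eq by (simp add: S_def)
      finally have "n < m" by linarith
      then show "i \<in> (\<lambda>n. m + (2 * n + 1) * l) ` {..<m}" using i_eq by blast
    qed
    show "\<forall>i\<in>(\<lambda>n. m + (2 * n + 1) * l) ` {..<m} - {i. i \<in> S \<and> m < i}. real (2 * m choose i) = 0"
    proof
      fix i assume i: "i \<in> (\<lambda>n. m + (2 * n + 1) * l) ` {..<m} - {i. i \<in> S \<and> m < i}"
      then obtain n where n: "i = m + (2 * n + 1) * l" by blast
      have "int i - int m + int l = 2 * int l * (int n + 1)"
        by (simp add: n algebra_simps)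
      moreover have "m < i" using l by (simp add: n)
      ultimately have "\<not> i \<le> 2 * m" using i by (auto simp: S_def)
      then show "real (2 * m choose i) = 0" by simp
    qed
  qed simp
  also have "\<dots> = (\<Sum>n<m. real (2 * m choose (m + (2 * n + 1) * l)))"
    using l by (subst sum.reindex) (auto simp: inj_on_def)
  finally show ?thesis by (simp add: S_def)
qed

text \<open>The indices \<open>j\<close> and \<open>2 * l - j\<close> give equal terms. The fixed
  index \<open>l\<close> contributes \<open>cos (pi / 2)\<close> to a positive power, which is 0,
  and \<open>j = 0\<close> contributes 1.\<close>

lemma sum_alternating_cos_power_symmetric:
  assumes "l > 0" "m > 0"
  shows "(\<Sum>j<2 * l. (-1) ^ j * cos (pi * real j / (2 * real l)) ^ (2 * m))
       = 1 + 2 * (\<Sum>j=1..<l. (-1) ^ j * cos (pi * real j / (2 * real l)) ^ (2 * m))"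
proof -
  define g where "g j = (-1) ^ j * cos (pi * real j / (2 * real l)) ^ (2 * m)" for j
  have g_reflect: "g (2 * l - j) = g j" if "j \<le> 2 * l" for j
  proof -
    have "pi * real (2 * l - j) / (2 * real l) = pi - pi * real j / (2 * real l)"
      using that assms by (simp add: of_nat_diff field_simps)
    then have "cos (pi * real (2 * l - j) / (2 * real l)) ^ (2 * m) = cos (pi * real j / (2 * real l)) ^ (2 * m)"
      by (simp add: power_mult)
    moreover have "(-1) ^ (2 * l - j) = ((-1) ^ j :: real)"
      using that by (auto simp: minus_one_power_iff)
    ultimately show ?thesis by (simp add: g_def)
  qed
  have "{..<2 * l} = insert 0 ({1..<l} \<union> insert l {Suc l..<2 * l})"
    using assms by auto
  then have "(\<Sum>j<2 * l. g j) = g 0 + ((\<Sum>j=1..<l. g j) + (g l + (\<Sum>j=Suc l..<2 * l. g j)))"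
    using assms by (simp add: sum.union_disjoint)
  also have "(\<Sum>j=Suc l..<2 * l. g j) = (\<Sum>j=1..<l. g j)"
    by (rule sum.reindex_bij_witness[of _ "\<lambda>j. 2 * l - j" "\<lambda>j. 2 * l - j"]) (auto simp: g_reflect)
  also have "g l = 0"
  proof -
    have "pi * real l / (2 * real l) = pi / 2" using assms by simp
    then show ?thesis using assms by (simp add: g_def)
  qed
  finally show ?thesis by (simp add: g_def)
qed

text \<open>The finite sum is extended by zero terms to a series, the form needed for dominated
  convergence.\<close>

lemma binomial_odd_multiples_trigonometric:
  assumes "l > 0" "m > 0"
  shows "2 * (\<Sum>n. real (2 * m choose (m + (2 * n + 1) * l))) * (2 * real l) = 4 ^ m *
         (1 + 2 * (\<Sum>j=1..<l. (-1) ^ j * cos (pi * real j / (2 * real l)) ^ (2 * m)))"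
proof -
  have "2 * m choose (m + (2 * n + 1) * l) = 0" if "n \<notin> {..<m}" for n
  proof -
    have "(2 * n + 1) * 1 \<le> (2 * n + 1) * l" using assms by (intro mult_le_mono) auto
    then have "2 * m < m + (2 * n + 1) * l" using that by auto
    then show ?thesis by (rule binomial_eq_0)
  qed
  then have "(\<Sum>n. real (2 * m choose (m + (2 * n + 1) * l)))
      = (\<Sum>n<m. real (2 * m choose (m + (2 * n + 1) * l)))"
    by (intro suminf_finite) auto
  with sum_alternating_cos_power_eq_sum_binomial[OF assms(1), of m]
  show ?thesis
    unfolding sum_binomial_odd_multiples[OF assms(1)] sum_alternating_cos_power_symmetric[OF assms]
    by (simp add: mult_ac)
qed

section \<open>Elementary exponential bounds for \<open>1 - z\<close> and the cosine\<close>

text \<open>Reciprocal of \<open>1 + y \<le> exp y\<close> at \<open>y = z / (1 - z)\<close>. It is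
  the lower counterpart of \<open>1 - z \<le> exp (- z)\<close>.\<close>

lemma exp_minus_divide_le:
  fixes z :: real
  assumes "z < 1"
  shows "exp (- (z / (1 - z))) \<le> 1 - z"
proof -
  have "1 / (1 - z) = 1 + z / (1 - z)" using assms by (simp add: field_simps)
  also have "\<dots> \<le> exp (z / (1 - z))" by (rule exp_ge_add_one_self)
  finally show ?thesis using assms by (simp add: exp_minus field_simps)
qed

text \<open>The function \<open>exp (x\<^sup>2 / 2) * cos x\<close> decreases, since its derivative
  has the sign of \<open>x * cos x - sin x\<close>. That this is nonpositive follows in the same way
  from its derivative \<open>- (x * sin x)\<close>.\<close>

lemma cos_le_exp_minus_half_square:
  fixes x :: real
  assumes "0 \<le> x" "x \<le> pi / 2"
  shows "cos x \<le> exp (- (x\<^sup>2 / 2))"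
proof -
  have sin_ge: "y * cos y \<le> sin y" if "0 \<le> y" "y \<le> pi / 2" for y :: real
  proof -
    have "0 * cos 0 - sin 0 \<ge> y * cos y - sin y"
    proof (rule DERIV_nonpos_imp_nonincreasing[OF that(1)])
      fix t assume t: "0 \<le> t" "t \<le> y"
      then have "- (t * sin t) \<le> 0" using that by (simp add: sin_ge_zero)
      moreover have "((\<lambda>t. t * cos t - sin t) has_real_derivative - (t * sin t)) (at t)"
        by (auto intro!: derivative_eq_intros)
      ultimately show "\<exists>d. ((\<lambda>t. t * cos t - sin t) has_real_derivative d) (at t) \<and> d \<le> 0"
        by blast
    qed
    then show ?thesis by simp
  qed
  have "exp (0\<^sup>2 / 2) * cos 0 \<ge> exp (x\<^sup>2 / 2) * cos x"
  proof (rule DERIV_nonpos_imp_nonincreasing[OF assms(1)])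
    fix t assume t: "0 \<le> t" "t \<le> x"
    then have "exp (t\<^sup>2 / 2) * (t * cos t - sin t) \<le> 0"
      using sin_ge[of t] assms by (simp add: mult_le_0_iff)
    moreover have "((\<lambda>t. exp (t\<^sup>2 / 2) * cos t) has_real_derivative
        exp (t\<^sup>2 / 2) * (t * cos t - sin t)) (at t)"
      by (auto intro!: derivative_eq_intros simp: algebra_simps)
    ultimately show "\<exists>d. ((\<lambda>t. exp (t\<^sup>2 / 2) * cos t) has_real_derivative d) (at t) \<and> d \<le> 0"
      by blast
  qed
  then show ?thesis by (simp add: exp_minus field_simps)
qed

lemma one_minus_half_square_le_cos: "1 - x\<^sup>2 / 2 \<le> cos (x::real)"
proof -
  have "(sin (x / 2))\<^sup>2 \<le> (x / 2)\<^sup>2"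
    using abs_sin_x_le_abs_x[of "x / 2"] by (simp add: abs_le_square_iff[symmetric])
  moreover have "cos x = 1 - 2 * (sin (x / 2))\<^sup>2"
    using cos_double_sin[of "x / 2"] by simp
  ultimately show ?thesis by (simp add: power_divide)
qed

section \<open>Gaussian bounds for binomial coefficients\<close>

definition binomial_ratio :: "nat \<Rightarrow> nat \<Rightarrow> real" where
  "binomial_ratio m k = real (2 * m choose (m + k)) / real (2 * m choose m)"

lemma binomial_ratio_0 [simp]: "binomial_ratio m 0 = 1"
  by (simp add: binomial_ratio_def)

lemma binomial_ratio_nonneg: "0 \<le> binomial_ratio m k"
  by (simp add: binomial_ratio_def)

lemma binomial_ratio_Suc:
  assumes "k \<le> m"
  shows "binomial_ratio m (Suc k) = binomial_ratio m k * ((real m - real k) / (real m + real k + 1))"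
proof -
  have "(2 * m choose Suc (m + k)) * Suc (m + k) = (2 * m choose (m + k)) * (2 * m - (m + k))"
    by (metis binomial_absorb_comp binomial_absorption mult.commute)
  then have "real (2 * m choose Suc (m + k)) * real (Suc (m + k))
      = real (2 * m choose (m + k)) * real (2 * m - (m + k))"
    by (simp only: flip: of_nat_mult)
  then have "real (2 * m choose Suc (m + k)) * (real m + real k + 1)
      = real (2 * m choose (m + k)) * (real m - real k)"
    using assms by (simp add: of_nat_diff add_ac)
  moreover have "real m + real k + 1 \<noteq> 0" by linarith
  ultimately have "real (2 * m choose Suc (m + k))
      = real (2 * m choose (m + k)) * (real m - real k) / (real m + real k + 1)"
    by (metis nonzero_eq_divide_eq)
  then show ?thesis
    by (simp add: binomial_ratio_def)
qed

text \<open>Each step multiplies by \<open>1 - (2 * k + 1) / (m + k + 1)\<close>, at most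
  \<open>exp (- ((2 * k + 1) / (m + K)))\<close> while \<open>k < K\<close>, and the odd numbers add
  up to a square. The limit uses \<open>K\<close> equal to the index, the uniform majorant uses
  \<open>K = m\<close>.\<close>

lemma binomial_ratio_le_exp:
  assumes "k \<le> K" "K \<le> m" "0 < m"
  shows "binomial_ratio m k \<le> exp (- ((real k)\<^sup>2 / (real m + real K)))"
  using assms(1)
proof (induction k)
  case (Suc k)
  have "(real m - real k) / (real m + real k + 1) = 1 - (2 * real k + 1) / (real m + real k + 1)"
    by (simp add: field_simps)
  also have "\<dots> \<le> 1 - (2 * real k + 1) / (real m + real K)"
    using Suc.prems by (simp add: frac_le)
  also have "\<dots> \<le> exp (- ((2 * real k + 1) / (real m + real K)))"
    using exp_ge_add_one_self[of "- ((2 * real k + 1) / (real m + real K))"] by simp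
  finally have "binomial_ratio m k * ((real m - real k) / (real m + real k + 1))
      \<le> exp (- ((real k)\<^sup>2 / (real m + real K))) * exp (- ((2 * real k + 1) / (real m + real K)))"
    using Suc assms by (intro mult_mono) auto
  also have "\<dots> = exp (- ((real (Suc k))\<^sup>2 / (real m + real K)))"
    by (simp add: power2_eq_square add_divide_distrib algebra_simps flip: exp_add)
  finally show ?case using Suc.prems assms by (simp add: binomial_ratio_Suc)
qed simp

text \<open>Here the factor \<open>1 - z\<close> has
  \<open>z / (1 - z) = (2 * k + 1) / (m - k)\<close>. A step from \<open>k\<close> needs only
  \<open>k \<le> K - 1\<close>, whence the \<open>+ 1\<close> in the denominator.\<close>

lemma binomial_ratio_ge_exp:
  assumes "k \<le> K" "K \<le> m"
  shows "exp (- ((real k)\<^sup>2 / (real m - real K + 1))) \<le> binomial_ratio m k"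
  using assms(1)
proof (induction k)
  case (Suc k)
  define z where "z = (2 * real k + 1) / (real m + real k + 1)"
  have km: "real k + 1 \<le> real m" using Suc.prems assms by simp
  have z: "1 - z = (real m - real k) / (real m + real k + 1)" by (simp add: z_def field_simps)
  have "z < 1" using km by (simp add: z_def)
  moreover have "z / (1 - z) = (2 * real k + 1) / (real m - real k)"
    unfolding z using km by (simp add: z_def)
  ultimately have "exp (- ((2 * real k + 1) / (real m - real k))) \<le> 1 - z"
    using exp_minus_divide_le[of z] by simp
  moreover have "(2 * real k + 1) / (real m - real k) \<le> (2 * real k + 1) / (real m - real K + 1)"
    using Suc.prems assms by (intro frac_le) auto
  ultimately have "exp (- ((2 * real k + 1) / (real m - real K + 1))) \<le> 1 - z"
    by (meson exp_le_cancel_iff neg_le_iff_le order.trans)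
  then have "exp (- ((real k)\<^sup>2 / (real m - real K + 1))) * exp (- ((2 * real k + 1) / (real m - real K + 1)))
      \<le> binomial_ratio m k * ((real m - real k) / (real m + real k + 1))"
    using Suc by (intro mult_mono) (auto simp: z binomial_ratio_nonneg)
  moreover have "exp (- ((real k)\<^sup>2 / (real m - real K + 1))) * exp (- ((2 * real k + 1) / (real m - real K + 1)))
      = exp (- ((real (Suc k))\<^sup>2 / (real m - real K + 1)))"
    by (simp add: power2_eq_square add_divide_distrib algebra_simps flip: exp_add)
  ultimately show ?case using Suc.prems assms by (simp add: binomial_ratio_Suc)
qed simp

lemma binomial_ratio_le_exp_uniform:
  assumes "0 < m"
  shows "binomial_ratio m k \<le> exp (- ((real k)\<^sup>2 / (2 * real m)))"
proof (cases "k \<le> m")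
  case True
  then show ?thesis using binomial_ratio_le_exp[of k m m] assms by simp
next
  case False
  then have zero: "2 * m choose (m + k) = 0" by (intro binomial_eq_0) simp
  show ?thesis unfolding binomial_ratio_def zero by simp
qed

section \<open>The central binomial coefficient from Wallis's product\<close>

text \<open>With \<open>W\<close> the partial Wallis product,
  \<open>(a n)\<^sup>2 * (2 * n + 1) * W n = 1\<close> holds exactly, by induction. The limit
  \<open>pi / 2\<close> of \<open>W\<close> then determines that of
  \<open>a n * sqrt n\<close>.\<close>

lemma central_binomial_tendsto:
  "(\<lambda>n. real (2 * n choose n) / 4 ^ n * sqrt (real n)) \<longlonglongrightarrow> 1 / sqrt pi"
proof -
  define a where "a n = real (2 * n choose n) / 4 ^ n" for n
  define W where "W n = (\<Prod>k=1..n. (4 * real k ^ 2) / (4 * real k ^ 2 - 1))" for n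
  have a_Suc: "a (Suc n) = a n * ((2 * real n + 1) / (2 * real n + 2))" for n
  proof -
    have "(2 * Suc n choose Suc n) * Suc n = 2 * (2 * n + 1) * (2 * n choose n)"
    proof -
      have "(2 * Suc n choose Suc n) * Suc n = 2 * Suc n * (Suc (2 * n) choose n)"
        using binomial_absorption[of n "2 * Suc n"] by (simp del: binomial_Suc_Suc add: mult.commute)
      moreover have "Suc n * (Suc (2 * n) choose n) = (2 * n + 1) * (2 * n choose n)"
        using binomial_absorb_comp[of "Suc (2 * n)" n] by (simp del: binomial_Suc_Suc)
      ultimately show ?thesis by (simp only: mult.assoc)
    qed
    then have "real (2 * Suc n choose Suc n) * (real n + 1) = 2 * (2 * real n + 1) * real (2 * n choose n)"
      by (metis (no_types, lifting) of_nat_mult of_nat_Suc of_nat_add of_nat_1 of_nat_numeral add.commute)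
    moreover have "real n + 1 \<noteq> 0" by linarith
    ultimately have "real (2 * Suc n choose Suc n)
        = 2 * (2 * real n + 1) * real (2 * n choose n) / (real n + 1)"
      by (metis nonzero_eq_divide_eq)
    moreover have "2 * X * C / N / (4 * F) = C / F * (X / (2 * N))" if "N \<noteq> 0" "F \<noteq> 0" for X C N F :: real
      using that by (simp add: field_simps)
    from this[of "real n + 1" "4 ^ n" "2 * real n + 1" "real (2 * n choose n)"]
    have "2 * (2 * real n + 1) * real (2 * n choose n) / (real n + 1) / 4 ^ Suc n
        = real (2 * n choose n) / 4 ^ n * ((2 * real n + 1) / (2 * real n + 2))"
      using \<open>real n + 1 \<noteq> 0\<close> by (simp add: distrib_left)
    ultimately show ?thesis unfolding a_def by (simp only:)
  qed
  have W_pos: "W n > 0" for n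
    unfolding W_def
  proof (intro prod_pos divide_pos_pos)
    fix k assume "k \<in> {1..n}"
    then have "1 \<le> real k ^ 2" by (intro one_le_power) simp
    then show "0 < 4 * real k ^ 2" "0 < 4 * real k ^ 2 - 1" by linarith+
  qed
  have "(a n)\<^sup>2 * (2 * real n + 1) * W n = 1" for n
  proof (induction n)
    case 0
    show ?case by (simp add: a_def W_def)
  next
    case (Suc n)
    have "W (Suc n) = W n * ((2 * real n + 2)\<^sup>2 / ((2 * real n + 1) * (2 * real n + 3)))"
      by (simp add: W_def power2_eq_square algebra_simps)
    then have "(a (Suc n))\<^sup>2 * (2 * real (Suc n) + 1) * W (Suc n)
        = ((a n)\<^sup>2 * (2 * real n + 1) * W n) *
          ((2 * real n + 1) / (2 * real n + 2)\<^sup>2 * (2 * real n + 3) * ((2 * real n + 2)\<^sup>2 / ((2 * real n + 1) * (2 * real n + 3))))"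
      by (simp add: a_Suc power_mult_distrib power_divide power2_eq_square mult_ac add_ac)
    also have "\<dots> = 1" unfolding Suc.IH by (simp add: divide_simps)
    finally show ?case .
  qed
  then have asq: "a n * sqrt (real n) = sqrt (real n / (2 * real n + 1) / W n)" for n
  proof -
    have "(2 * real n + 1) * W n \<noteq> 0" using W_pos[of n] by (simp add: add_nonneg_eq_0_iff)
    then have "(a n)\<^sup>2 = 1 / ((2 * real n + 1) * W n)"
      using \<open>(a n)\<^sup>2 * (2 * real n + 1) * W n = 1\<close> by (metis mult.assoc nonzero_eq_divide_eq)
    then have "(a n)\<^sup>2 * real n = real n / (2 * real n + 1) / W n" by simp
    moreover have "a n \<ge> 0" by (simp add: a_def)
    ultimately show ?thesis by (metis real_sqrt_abs real_sqrt_mult abs_of_nonneg)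
  qed
  have "(\<lambda>n. real n / (2 * real n + 1)) \<longlonglongrightarrow> 1 / 2"
    by real_asymp
  moreover have "W \<longlonglongrightarrow> pi / 2" using wallis unfolding W_def .
  ultimately have "(\<lambda>n. sqrt (real n / (2 * real n + 1) / W n)) \<longlonglongrightarrow> sqrt (1 / 2 / (pi / 2))"
    by (intro tendsto_real_sqrt, rule tendsto_divide) simp_all
  then show ?thesis
    unfolding asq[symmetric] by (simp add: a_def real_sqrt_divide)
qed

section \<open>Termwise limits and domination for both sides\<close>

text \<open>Tannery's theorem, with the majorant valid for all \<open>k\<close> at once from some
  \<open>n\<close> on.\<close>

lemma tendsto_suminf_dominated:
  fixes a :: "nat \<Rightarrow> nat \<Rightarrow> real"
  assumes "\<And>k. (\<lambda>n. a k n) \<longlonglongrightarrow> b k"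
    and bound: "\<forall>\<^sub>F n in sequentially. \<forall>k. \<bar>a k n\<bar> \<le> M k"
    and "summable M"
  shows "(\<lambda>n. \<Sum>k. a k n) \<longlonglongrightarrow> (\<Sum>k. b k)"
proof -
  have "eventually (\<lambda>(k, n). norm (a k n) \<le> M k) (at_top \<times>\<^sub>F sequentially)"
    unfolding eventually_prod_filter
    using bound by (intro exI[of _ "\<lambda>_. True"] exI[of _ "\<lambda>n. \<forall>k. \<bar>a k n\<bar> \<le> M k"]) auto
  from tannerys_theorem[OF assms(1) this assms(3)] show ?thesis by simp
qed

lemma summable_exp_minus_nat:
  fixes c :: real
  assumes "c > 0"
  shows "summable (\<lambda>n. exp (- (c * real n)))"
proof -
  have "exp (- (c * real n)) = exp (- c) ^ n" for n
    by (simp add: mult.commute flip: exp_of_nat_mult)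
  then show ?thesis using assms by (simp add: summable_geometric)
qed

context
  fixes m :: "nat \<Rightarrow> nat" and c :: real
  assumes c: "c > 0" and m_lim: "(\<lambda>l. real (m l) / (real l)\<^sup>2) \<longlonglongrightarrow> 1 / c"
begin

text \<open>Both Gaussian bounds are taken with \<open>k = K = p * l\<close>. After division by
  \<open>l\<^sup>2\<close> their denominators tend to \<open>1 / c\<close>.\<close>

lemma binomial_ratio_tendsto_exp:
  "(\<lambda>l. binomial_ratio (m l) (p * l)) \<longlonglongrightarrow> exp (- (c * (real p)\<^sup>2))"
proof (rule tendsto_sandwich)
  define x where "x l = real (m l) / (real l)\<^sup>2" for l
  have x: "x \<longlonglongrightarrow> 1 / c" using m_lim unfolding x_def .
  have pl: "(\<lambda>l. real p / real l) \<longlonglongrightarrow> 0" by (rule lim_const_over_n)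
  have l2: "(\<lambda>l. 1 / (real l)\<^sup>2) \<longlonglongrightarrow> 0" by real_asymp
  \<comment> \<open>Since \<open>m l\<close> grows quadratically it overtakes \<open>p * l\<close>,
    as both bounds require.\<close>
  have "(\<lambda>l. real p / real l - x l) \<longlonglongrightarrow> 0 - 1 / c" by (intro tendsto_diff pl x)
  then have "\<forall>\<^sub>F l in sequentially. real p / real l - x l < 0"
    using c by (intro order_tendstoD) auto
  then have ev: "\<forall>\<^sub>F l in sequentially. 0 < l \<and> p * l \<le> m l"
    using eventually_gt_at_top[of 0]
  proof eventually_elim
    case (elim l)
    then have "real p * real l < real (m l)"
      by (simp add: x_def field_simps power2_eq_square)
    then have "p * l < m l" by (simp flip: of_nat_mult)
    then show ?case using elim by simp
  qed
  show "(\<lambda>l. exp (- ((real p)\<^sup>2 / (x l - real p / real l + 1 / (real l)\<^sup>2)))) \<longlonglongrightarrow> exp (- (c * (real p)\<^sup>2))"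
  proof -
    have "(\<lambda>l. exp (- ((real p)\<^sup>2 / (x l - real p / real l + 1 / (real l)\<^sup>2))))
        \<longlonglongrightarrow> exp (- ((real p)\<^sup>2 / (1 / c - 0 + 0)))"
      using c by (intro tendsto_intros x pl l2) auto
    then show ?thesis by (simp add: mult.commute)
  qed
  show "(\<lambda>l. exp (- ((real p)\<^sup>2 / (x l + real p / real l)))) \<longlonglongrightarrow> exp (- (c * (real p)\<^sup>2))"
  proof -
    have "(\<lambda>l. exp (- ((real p)\<^sup>2 / (x l + real p / real l)))) \<longlonglongrightarrow> exp (- ((real p)\<^sup>2 / (1 / c + 0)))"
      using c by (intro tendsto_intros x pl) auto
    then show ?thesis by (simp add: mult.commute)
  qed
  show "\<forall>\<^sub>F l in sequentially. binomial_ratio (m l) (p * l) \<le> exp (- ((real p)\<^sup>2 / (x l + real p / real l)))"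
    using ev
  proof eventually_elim
    case (elim l)
    have "(real (p * l))\<^sup>2 / (real (m l) + real (p * l)) = (real p)\<^sup>2 / (x l + real p / real l)"
    proof (cases "p = 0")
      case False
      have "x l + real p / real l = (real (m l) + real (p * l)) / (real l)\<^sup>2"
        using elim by (simp add: x_def power2_eq_square add_divide_distrib)
      then show ?thesis by (simp add: power_mult_distrib)
    qed simp
    moreover have "0 < m l \<or> p = 0" using elim by (cases "m l") auto
    ultimately show ?case
      using elim binomial_ratio_le_exp[of "p * l" "p * l" "m l"] by auto
  qed
  show "\<forall>\<^sub>F l in sequentially. exp (- ((real p)\<^sup>2 / (x l - real p / real l + 1 / (real l)\<^sup>2))) \<le> binomial_ratio (m l) (p * l)"
    using ev
  proof eventually_elim
    case (elim l)
    have "x l - real p / real l + 1 / (real l)\<^sup>2 = (real (m l) - real (p * l) + 1) / (real l)\<^sup>2"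
      using elim by (simp add: x_def power2_eq_square add_divide_distrib diff_divide_distrib)
    then have "(real p)\<^sup>2 / (x l - real p / real l + 1 / (real l)\<^sup>2)
        = (real (p * l))\<^sup>2 / (real (m l) - real (p * l) + 1)"
      by (simp add: power_mult_distrib)
    then show ?case
      using elim binomial_ratio_ge_exp[of "p * l" "p * l" "m l"] by simp
  qed
qed

text \<open>With \<open>y = pi * j / (2 * l)\<close>, the cosine lies between
  \<open>1 - y\<^sup>2 / 2\<close> and \<open>exp (- (y\<^sup>2 / 2))\<close>. Their powers have the
  same limit because \<open>m l * y\<^sup>2\<close> converges.\<close>

lemma cos_power_tendsto_exp:
  "(\<lambda>l. cos (pi * real j / (2 * real l)) ^ (2 * m l)) \<longlonglongrightarrow> exp (- (pi\<^sup>2 * (real j)\<^sup>2 / (4 * c)))"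
proof (rule tendsto_sandwich)
  define x where "x l = real (m l) / (real l)\<^sup>2" for l
  define y where "y l = pi * real j / (2 * real l)" for l :: nat
  define D where "D = pi\<^sup>2 * (real j)\<^sup>2 / 4"
  have x: "x \<longlonglongrightarrow> 1 / c" using m_lim unfolding x_def .
  have y: "y \<longlonglongrightarrow> 0" unfolding y_def by real_asymp
  \<comment> \<open>At \<open>l = 0\<close> both sides are 0, by the convention for division by
    zero.\<close>
  have my: "real (m l) * (y l)\<^sup>2 = D * x l" for l
    by (simp add: y_def x_def D_def power_divide power_mult_distrib)
  have "(\<lambda>l. (y l)\<^sup>2 / 2) \<longlonglongrightarrow> 0\<^sup>2 / 2" by (intro tendsto_intros y) simp
  then have "\<forall>\<^sub>F l in sequentially. (y l)\<^sup>2 / 2 < 1"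
    by (rule order_tendstoD) simp
  moreover have "\<forall>\<^sub>F l in sequentially. y l < pi / 2"
    using y by (intro order_tendstoD) auto
  ultimately have ev: "\<forall>\<^sub>F l in sequentially. (y l)\<^sup>2 / 2 < 1 \<and> y l \<le> pi / 2"
    by eventually_elim simp
  show "(\<lambda>l. exp (- (D * x l / (1 - (y l)\<^sup>2 / 2)))) \<longlonglongrightarrow> exp (- (pi\<^sup>2 * (real j)\<^sup>2 / (4 * c)))"
  proof -
    have "(\<lambda>l. exp (- (D * x l / (1 - (y l)\<^sup>2 / 2)))) \<longlonglongrightarrow> exp (- (D * (1 / c) / (1 - 0\<^sup>2 / 2)))"
      by (intro tendsto_intros x y) auto
    then show ?thesis by (simp add: D_def)
  qed
  show "(\<lambda>l. exp (- (D * x l))) \<longlonglongrightarrow> exp (- (pi\<^sup>2 * (real j)\<^sup>2 / (4 * c)))"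
  proof -
    have "(\<lambda>l. exp (- (D * x l))) \<longlonglongrightarrow> exp (- (D * (1 / c)))"
      by (intro tendsto_intros x)
    then show ?thesis by (simp add: D_def)
  qed
  show "\<forall>\<^sub>F l in sequentially. cos (pi * real j / (2 * real l)) ^ (2 * m l) \<le> exp (- (D * x l))"
    using ev
  proof eventually_elim
    case (elim l)
    have "y l \<ge> 0" by (simp add: y_def)
    then have "cos (y l) ^ (2 * m l) \<le> exp (- ((y l)\<^sup>2 / 2)) ^ (2 * m l)"
      using elim by (intro power_mono cos_le_exp_minus_half_square cos_ge_zero) auto
    also have "\<dots> = exp (- (D * x l))"
      by (simp flip: exp_of_nat_mult my)
    finally show ?case by (simp add: y_def)
  qed
  show "\<forall>\<^sub>F l in sequentially. exp (- (D * x l / (1 - (y l)\<^sup>2 / 2))) \<le> cos (pi * real j / (2 * real l)) ^ (2 * m l)"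
    using ev
  proof eventually_elim
    case (elim l)
    define z where "z = (y l)\<^sup>2 / 2"
    have "exp (- (z / (1 - z))) \<le> 1 - z" using elim by (intro exp_minus_divide_le) (simp add: z_def)
    also have "\<dots> \<le> cos (y l)" unfolding z_def by (rule one_minus_half_square_le_cos)
    finally have "exp (- (z / (1 - z))) ^ (2 * m l) \<le> cos (y l) ^ (2 * m l)"
      by (intro power_mono) auto
    moreover have "exp (- (z / (1 - z))) ^ (2 * m l) = exp (- (D * x l / (1 - z)))"
    proof -
      have "D * x l = 2 * real (m l) * z" by (simp add: z_def flip: my)
      then show ?thesis by (simp flip: exp_of_nat_mult)
    qed
    ultimately show ?case by (simp add: y_def z_def)
  qed
qed

lemma suminf_binomial_ratio_tendsto:
  "(\<lambda>l. \<Sum>n. binomial_ratio (m l) ((2 * n + 1) * l)) \<longlonglongrightarrow> (\<Sum>n. exp (- (c * (2 * real n + 1)\<^sup>2)))"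
proof (rule tendsto_suminf_dominated)
  show "(\<lambda>l. binomial_ratio (m l) ((2 * n + 1) * l)) \<longlonglongrightarrow> exp (- (c * (2 * real n + 1)\<^sup>2))" for n
    using binomial_ratio_tendsto_exp[of "2 * n + 1"] by (simp add: add.commute)
  \<comment> \<open>The uniform bound has exponent
    \<open>(2 * n + 1)\<^sup>2 * l\<^sup>2 / (2 * m l)\<close>, and eventually
    \<open>l\<^sup>2 / m l\<close> exceeds \<open>c / 2\<close>; this gives the rate
    \<open>c / 4\<close>.\<close>
  show "summable (\<lambda>n. exp (- (c / 4 * real n)))"
    using c by (intro summable_exp_minus_nat) simp
  have "\<forall>\<^sub>F l in sequentially. real (m l) / (real l)\<^sup>2 < 2 / c"
    using c by (intro order_tendstoD(2)[OF m_lim]) (simp add: divide_strict_right_mono)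
  moreover have "\<forall>\<^sub>F l in sequentially. 0 < real (m l) / (real l)\<^sup>2"
    using c by (intro order_tendstoD(1)[OF m_lim]) simp
  ultimately show "\<forall>\<^sub>F l in sequentially. \<forall>n. \<bar>binomial_ratio (m l) ((2 * n + 1) * l)\<bar> \<le> exp (- (c / 4 * real n))"
  proof eventually_elim
    case (elim l)
    have l: "0 < real l" "0 < real (m l)" using elim by (auto simp: zero_less_divide_iff)
    have ml: "c / 2 * real (m l) \<le> (real l)\<^sup>2"
      using elim c l by (simp add: field_simps)
    show ?case
    proof
      fix n
      have "real n \<le> (2 * real n + 1)\<^sup>2" by (simp add: power2_eq_square algebra_simps)
      then have "c / 4 * real n \<le> c / 4 * (2 * real n + 1)\<^sup>2"
        using c by (intro mult_left_mono) auto
      also have "\<dots> = (2 * real n + 1)\<^sup>2 * (c / 2 * real (m l)) / (2 * real (m l))"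
        using l by simp
      also have "\<dots> \<le> (2 * real n + 1)\<^sup>2 * (real l)\<^sup>2 / (2 * real (m l))"
        using ml l by (intro divide_right_mono mult_left_mono) auto
      also have "\<dots> = (real ((2 * n + 1) * l))\<^sup>2 / (2 * real (m l))"
        by (simp only: power_mult_distrib of_nat_mult of_nat_add of_nat_numeral of_nat_1)
      finally have "exp (- ((real ((2 * n + 1) * l))\<^sup>2 / (2 * real (m l)))) \<le> exp (- (c / 4 * real n))"
        by simp
      moreover have "binomial_ratio (m l) ((2 * n + 1) * l) \<le> exp (- ((real ((2 * n + 1) * l))\<^sup>2 / (2 * real (m l))))"
        using l by (intro binomial_ratio_le_exp_uniform) simp
      ultimately show "\<bar>binomial_ratio (m l) ((2 * n + 1) * l)\<bar> \<le> exp (- (c / 4 * real n))"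
        using binomial_ratio_nonneg[of "m l" "(2 * n + 1) * l"] by linarith
    qed
  qed
qed

lemma sum_alternating_cos_power_tendsto:
  "(\<lambda>l. \<Sum>j=1..<l. (-1) ^ j * cos (pi * real j / (2 * real l)) ^ (2 * m l)) \<longlonglongrightarrow>
   (\<Sum>j. (-1) ^ Suc j * exp (- (pi\<^sup>2 * (real (Suc j))\<^sup>2 / (4 * c))))"
proof -
  \<comment> \<open>Cutting off at \<open>l\<close> is essential for domination: beyond
    \<open>j = l\<close> the even powers of the cosine grow again.\<close>
  define a where "a j l = (if Suc j < l then
    (-1) ^ Suc j * cos (pi * real (Suc j) / (2 * real l)) ^ (2 * m l) else 0)" for j l
  \<comment> \<open>Eventually \<open>m l / l\<^sup>2\<close> exceeds half its limit
    \<open>1 / c\<close>; multiplied by \<open>pi\<^sup>2 / 4\<close> this gives the decay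
    rate.\<close>
  define K where "K = pi\<^sup>2 / (8 * c)"
  have K: "K > 0" using c by (simp add: K_def)
  have "(\<lambda>l. \<Sum>j. a j l) \<longlonglongrightarrow> (\<Sum>j. (-1) ^ Suc j * exp (- (pi\<^sup>2 * (real (Suc j))\<^sup>2 / (4 * c))))"
  proof (rule tendsto_suminf_dominated)
    fix j
    have "(\<lambda>l. (-1) ^ Suc j * cos (pi * real (Suc j) / (2 * real l)) ^ (2 * m l))
        \<longlonglongrightarrow> (-1) ^ Suc j * exp (- (pi\<^sup>2 * (real (Suc j))\<^sup>2 / (4 * c)))"
      by (intro tendsto_mult tendsto_const cos_power_tendsto_exp)
    moreover have "\<forall>\<^sub>F l in sequentially.
        (-1) ^ Suc j * cos (pi * real (Suc j) / (2 * real l)) ^ (2 * m l) = a j l"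
      using eventually_gt_at_top[of "Suc j"] by eventually_elim (simp add: a_def)
    ultimately show "(\<lambda>l. a j l) \<longlonglongrightarrow> (-1) ^ Suc j * exp (- (pi\<^sup>2 * (real (Suc j))\<^sup>2 / (4 * c)))"
      by (rule Lim_transform_eventually)
  next
    show "summable (\<lambda>j. exp (- (K * real j)))"
      using K by (rule summable_exp_minus_nat)
    have "\<forall>\<^sub>F l in sequentially. 1 / (2 * c) < real (m l) / (real l)\<^sup>2"
      using c by (intro order_tendstoD(1)[OF m_lim]) (simp add: field_simps)
    then show "\<forall>\<^sub>F l in sequentially. \<forall>j. \<bar>a j l\<bar> \<le> exp (- (K * real j))"
    proof eventually_elim
      case (elim l)
      show ?case
      proof
        fix j
        show "\<bar>a j l\<bar> \<le> exp (- (K * real j))"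
        proof (cases "Suc j < l")
          case True
          define y where "y = pi * real (Suc j) / (2 * real l)"
          have l: "real l > 0" using True by simp
          have "real (Suc j) \<le> real l" using True by simp
          then have "pi * real (Suc j) \<le> pi * real l" by (intro mult_left_mono) auto
          then have y: "0 \<le> y" "y \<le> pi / 2"
            using l by (auto simp: y_def field_simps)
          have "a j l = (-1) ^ Suc j * cos y ^ (2 * m l)"
            using True by (simp only: a_def y_def if_True)
          moreover have "cos y \<ge> 0" using y by (intro cos_ge_zero) auto
          ultimately have "\<bar>a j l\<bar> = cos y ^ (2 * m l)"
            by (simp add: abs_mult power_abs)
          also have "\<dots> \<le> exp (- (y\<^sup>2 / 2)) ^ (2 * m l)"
            using y by (intro power_mono cos_le_exp_minus_half_square cos_ge_zero) auto
          also have "\<dots> = exp (- (real (m l) * y\<^sup>2))"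
            by (simp flip: exp_of_nat_mult)
          also have "\<dots> \<le> exp (- (K * real j))"
          proof -
            have "real j \<le> (real (Suc j))\<^sup>2" by (simp add: power2_eq_square algebra_simps)
            then have "K * real j \<le> K * (real (Suc j))\<^sup>2" using K by (intro mult_left_mono) auto
            also have "\<dots> = pi\<^sup>2 * (real (Suc j))\<^sup>2 / 4 * (1 / (2 * c))"
              by (simp add: K_def)
            also have "\<dots> \<le> pi\<^sup>2 * (real (Suc j))\<^sup>2 / 4 * (real (m l) / (real l)\<^sup>2)"
              using elim by (intro mult_left_mono) auto
            also have "\<dots> = real (m l) * y\<^sup>2"
              by (simp add: y_def power_divide power_mult_distrib)
            finally show ?thesis by simp
          qed
          finally show ?thesis .
        qed (simp add: a_def)
      qed
    qed
  qed
  moreover have "(\<Sum>j. a j l) = (\<Sum>j=1..<l. (-1) ^ j * cos (pi * real j / (2 * real l)) ^ (2 * m l))" for l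
  proof -
    have "(\<Sum>j. a j l) = (\<Sum>j<l - 1. a j l)"
      by (rule suminf_finite) (auto simp: a_def)
    also have "\<dots> = (\<Sum>j=1..<l. (-1) ^ j * cos (pi * real j / (2 * real l)) ^ (2 * m l))"
      by (rule sum.reindex_bij_witness[of _ "\<lambda>j. j - 1" Suc]) (auto simp: a_def)
    finally show ?thesis .
  qed
  ultimately show ?thesis by simp
qed

end

section \<open>The functional equation\<close>

text \<open>The finite identity, divided by \<open>4 ^ m l * (2 * l)\<close> and multiplied by
  \<open>sqrt (m l)\<close>, has convergent sides; uniqueness of the limit gives the equation, and
  \<open>sqrt pi\<close> cancels.\<close>

lemma gaussian_sum_odd_functional_equation:
  fixes s :: real
  assumes s: "s > 0"
  shows "2 * (\<Sum>n. exp (- (pi * s * (2 * real n + 1)\<^sup>2))) =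
    (1 + 2 * (\<Sum>j. (-1) ^ Suc j * exp (- (pi / (4 * s))) ^ ((Suc j)\<^sup>2))) / (2 * sqrt s)"
proof -
  define c where "c = pi * s"
  have c: "c > 0" using s by (simp add: c_def)
  \<comment> \<open>Rounding up gives the required growth and keeps \<open>m l\<close> positive for
    \<open>l > 0\<close>.\<close>
  define m where "m l = nat \<lceil>(real l)\<^sup>2 / c\<rceil>" for l :: nat
  have m_bounds: "(real l)\<^sup>2 / c \<le> real (m l)" "real (m l) \<le> (real l)\<^sup>2 / c + 1" for l
  proof -
    have "0 \<le> (real l)\<^sup>2 / c" using c by simp
    then have "real (m l) = of_int \<lceil>(real l)\<^sup>2 / c\<rceil>" unfolding m_def by simp
    then show "(real l)\<^sup>2 / c \<le> real (m l)" "real (m l) \<le> (real l)\<^sup>2 / c + 1" by linarith+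
  qed
  have m_lim: "(\<lambda>l. real (m l) / (real l)\<^sup>2) \<longlonglongrightarrow> 1 / c"
  proof (rule tendsto_sandwich)
    show "(\<lambda>_. 1 / c) \<longlonglongrightarrow> 1 / c" by simp
    have "(\<lambda>l. 1 / c + 1 / (real l)\<^sup>2) \<longlonglongrightarrow> 1 / c + 0"
      by (intro tendsto_add tendsto_const) real_asymp
    then show "(\<lambda>l. 1 / c + 1 / (real l)\<^sup>2) \<longlonglongrightarrow> 1 / c" by simp
    show "\<forall>\<^sub>F l in sequentially. 1 / c \<le> real (m l) / (real l)\<^sup>2"
      using eventually_gt_at_top[of 0]
    proof eventually_elim
      case (elim l)
      then show ?case using divide_right_mono[OF m_bounds(1)[of l], of "(real l)\<^sup>2"] by simp
    qed
    show "\<forall>\<^sub>F l in sequentially. real (m l) / (real l)\<^sup>2 \<le> 1 / c + 1 / (real l)\<^sup>2"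
      using eventually_gt_at_top[of 0]
    proof eventually_elim
      case (elim l)
      then show ?case
        using divide_right_mono[OF m_bounds(2)[of l], of "(real l)\<^sup>2"] by (simp add: add_divide_distrib)
    qed
  qed
  have m_top: "filterlim m at_top sequentially"
  proof -
    have "filterlim (\<lambda>l. (real l)\<^sup>2 / c) at_top sequentially"
      using c by real_asymp
    then have "filterlim (\<lambda>l. real (m l)) at_top sequentially"
      by (rule filterlim_at_top_mono) (simp add: m_bounds)
    then show ?thesis by (simp add: filterlim_sequentially_iff_filterlim_real)
  qed
  define A where "A l = (\<Sum>n. binomial_ratio (m l) ((2 * n + 1) * l))" for l
  define B where "B l = (\<Sum>j=1..<l. (-1) ^ j * cos (pi * real j / (2 * real l)) ^ (2 * m l))" for l
  define w where "w k = real (2 * k choose k) / 4 ^ k * sqrt (real k)" for k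
  have lhs: "(\<lambda>l. 2 * w (m l) * A l) \<longlonglongrightarrow> 2 * (1 / sqrt pi) * (\<Sum>n. exp (- (c * (2 * real n + 1)\<^sup>2)))"
    unfolding A_def
    by (intro tendsto_mult tendsto_const suminf_binomial_ratio_tendsto[OF c m_lim]
        filterlim_compose[OF central_binomial_tendsto[folded w_def] m_top])
  have rhs: "(\<lambda>l. sqrt (real (m l) / (real l)\<^sup>2) / 2 * (1 + 2 * B l)) \<longlonglongrightarrow> sqrt (1 / c) / 2 *
      (1 + 2 * (\<Sum>j. (-1) ^ Suc j * exp (- (pi\<^sup>2 * (real (Suc j))\<^sup>2 / (4 * c)))))"
    unfolding B_def
    by (intro tendsto_mult tendsto_add tendsto_const tendsto_divide tendsto_real_sqrt m_lim
        sum_alternating_cos_power_tendsto[OF c m_lim]) simp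
  have "\<forall>\<^sub>F l in sequentially. 2 * w (m l) * A l = sqrt (real (m l) / (real l)\<^sup>2) / 2 * (1 + 2 * B l)"
    using eventually_gt_at_top[of 0]
  proof eventually_elim
    case (elim l)
    have "0 < (real l)\<^sup>2 / c" using elim c by simp
    then have m: "m l > 0" using m_bounds(1)[of l] by linarith
    define C where "C = real (2 * m l choose m l)"
    have C: "C > 0" by (simp add: C_def)
    have "A l = (\<Sum>n. real (2 * m l choose (m l + (2 * n + 1) * l)) / C)"
      by (simp add: A_def binomial_ratio_def C_def)
    also have "\<dots> = (\<Sum>n. real (2 * m l choose (m l + (2 * n + 1) * l))) / C"
    proof (rule suminf_divide, rule summable_finite)
      show "finite {..m l}" by simp
      fix n assume n: "n \<notin> {..m l}"
      have "(2 * n + 1) * 1 \<le> (2 * n + 1) * l" using elim by (intro mult_le_mono) auto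
      then have "2 * m l < m l + (2 * n + 1) * l" using n by auto
      then show "real (2 * m l choose (m l + (2 * n + 1) * l)) = 0" by simp
    qed
    finally have "2 * A l * C * (2 * real l) = 4 ^ m l * (1 + 2 * B l)"
      using binomial_odd_multiples_trigonometric[OF elim m] C by (simp add: B_def)
    then have eq: "2 * (C / 4 ^ m l) * A l = (1 + 2 * B l) / (2 * real l)"
      using elim by (simp add: field_simps)
    have "2 * w (m l) * A l = sqrt (real (m l)) * (2 * (C / 4 ^ m l) * A l)"
      by (simp add: w_def C_def)
    also have "\<dots> = sqrt (real (m l) / (real l)\<^sup>2) / 2 * (1 + 2 * B l)"
      unfolding eq using elim by (simp add: real_sqrt_divide)
    finally show ?case .
  qed
  from Lim_transform_eventually[OF lhs this] rhs
  have "2 * (1 / sqrt pi) * (\<Sum>n. exp (- (c * (2 * real n + 1)\<^sup>2))) = sqrt (1 / c) / 2 *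
      (1 + 2 * (\<Sum>j. (-1) ^ Suc j * exp (- (pi\<^sup>2 * (real (Suc j))\<^sup>2 / (4 * c)))))"
    by (rule LIMSEQ_unique)
  moreover have "exp (- (pi\<^sup>2 * (real (Suc j))\<^sup>2 / (4 * c))) = exp (- (pi / (4 * s))) ^ ((Suc j)\<^sup>2)" for j
  proof -
    have "pi\<^sup>2 * u / (4 * c) = u * (pi / (4 * s))" for u
      using s by (simp add: c_def power2_eq_square)
    then show ?thesis by (simp only: of_nat_power mult_minus_right flip: exp_of_nat_mult)
  qed
  moreover have "sqrt (1 / c) = 1 / (sqrt pi * sqrt s)"
    by (simp add: c_def real_sqrt_mult real_sqrt_divide)
  ultimately show ?thesis using s by (simp add: c_def field_simps)
qed

subsection \<open>The product formula\<close>

text \<open>The integers split into \<open>n\<close> and \<open>- n - 1\<close> for natural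
  \<open>n\<close>; these give opposite odd numbers, hence equal terms.\<close>

lemma theta_o_eq_suminf:
  assumes "s > 0"
  shows "theta_o s = 2 * (\<Sum>n. exp (- (pi * s * (2 * real n + 1)\<^sup>2)))"
proof -
  define f where "f k = exp (- pi * (2 * of_int k + 1)\<^sup>2 * s)" for k :: int
  define S where "S = (\<Sum>n. exp (- (pi * s * (2 * real n + 1)\<^sup>2)))"
  have "summable (\<lambda>n. exp (- (pi * s * (2 * real n + 1)\<^sup>2)))"
  proof (rule summable_comparison_test')
    show "summable (\<lambda>n. exp (- (pi * s * real n)))"
      using assms by (intro summable_exp_minus_nat) simp
    fix n
    have "real n \<le> (2 * real n + 1)\<^sup>2" by (simp add: power2_eq_square algebra_simps)
    then show "norm (exp (- (pi * s * (2 * real n + 1)\<^sup>2))) \<le> exp (- (pi * s * real n))"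
      using assms by (simp add: mult_left_mono)
  qed
  then have "(\<lambda>n. exp (- (pi * s * (2 * real n + 1)\<^sup>2))) sums S"
    unfolding S_def by (rule summable_sums)
  then have S: "((\<lambda>n. exp (- (pi * s * (2 * real n + 1)\<^sup>2))) has_sum S) UNIV"
    by (rule sums_nonneg_imp_has_sum) simp
  have "(f has_sum S) (range int)"
    by (subst has_sum_reindex) (use S in \<open>auto simp: f_def o_def mult_ac\<close>)
  moreover have "(f has_sum S) (range (\<lambda>n. - int n - 1))"
  proof (subst has_sum_reindex)
    have "(2 * (- real n - 1) + 1)\<^sup>2 = (2 * real n + 1)\<^sup>2" for n
      by (simp add: power2_eq_square algebra_simps)
    then show "((f \<circ> (\<lambda>n. - int n - 1)) has_sum S) UNIV"
      using S by (simp add: f_def o_def mult_ac)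
  qed (auto simp: inj_on_def)
  moreover have "range int \<inter> range (\<lambda>n. - int n - 1) = {}" by auto
  ultimately have "(f has_sum (S + S)) (range int \<union> range (\<lambda>n. - int n - 1))"
    by (rule has_sum_Un_disjoint)
  moreover have "range int \<union> range (\<lambda>n. - int n - 1) = UNIV"
  proof -
    have "k \<in> range int \<union> range (\<lambda>n. - int n - 1)" for k :: int
    proof (cases "k \<ge> 0")
      case True
      then show ?thesis by (metis UnI1 nat_0_le rangeI)
    next
      case False
      then have "k = - int (nat (- k - 1)) - 1" by simp
      then show ?thesis by blast
    qed
    then show ?thesis by blast
  qed
  ultimately have "infsum f UNIV = 2 * S" by (simp add: infsumI)
  moreover have "theta_o s = infsum f UNIV"
    unfolding theta_o_def by (intro infsum_cong) (simp add: f_def)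
  ultimately show ?thesis by (simp only: S_def)
qed

text \<open>The functional equation is combined with Gauss's product at
  \<open>q = exp (- (pi / (4 * s)))\<close>. Finite products are kept so that factors can be
  compared before the limit is taken.\<close>

lemma tanh_product_tendsto_theta_o:
  assumes s: "s > 0"
  shows "(\<lambda>n. (\<Prod>k=1..n. tanh (real k * (pi / (8 * s)))) / (2 * sqrt s)) \<longlonglongrightarrow> theta_o s"
proof -
  define q where "q = exp (- (pi / (4 * s)))"
  have q: "0 \<le> q" "q < 1" using s by (auto simp: q_def)
  \<comment> \<open>Gauss's identity is available only as a difference tending to 0, so convergence
    of the series has to be supplied.\<close>
  have "summable (\<lambda>j. (-1) ^ Suc j * q ^ ((Suc j)\<^sup>2))"
  proof (rule summable_comparison_test')
    show "summable (\<lambda>j. q ^ j)" using q by (simp add: summable_geometric)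
    fix j
    have "j \<le> (Suc j)\<^sup>2" by (simp add: power2_eq_square)
    then show "norm ((-1) ^ Suc j * q ^ ((Suc j)\<^sup>2)) \<le> q ^ j"
      using q by (simp add: abs_mult power_abs power_decreasing del: power_Suc)
  qed
  then have "(\<lambda>n. \<Sum>j<n. (-1) ^ Suc j * q ^ ((Suc j)\<^sup>2)) \<longlonglongrightarrow> (\<Sum>j. (-1) ^ Suc j * q ^ ((Suc j)\<^sup>2))"
    by (rule summable_LIMSEQ)
  moreover have "(\<Sum>j<n. (-1) ^ Suc j * q ^ ((Suc j)\<^sup>2)) = (\<Sum>j=1..n. (-1) ^ j * q ^ (j\<^sup>2))" for n
    by (rule sum.reindex_bij_witness[of _ "\<lambda>j. j - 1" Suc]) auto
  ultimately have "(\<lambda>n. 1 + 2 * (\<Sum>j=1..n. (-1) ^ j * q ^ (j\<^sup>2)))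
      \<longlonglongrightarrow> 1 + 2 * (\<Sum>j. (-1) ^ Suc j * q ^ ((Suc j)\<^sup>2))"
    by (intro tendsto_intros) simp
  from tendsto_add[OF gauss_product_minus_partial_sum_tendsto_0[OF q] this]
  have "(\<lambda>n. \<Prod>k=1..n. (1 - q ^ k) / (1 + q ^ k)) \<longlonglongrightarrow> 1 + 2 * (\<Sum>j. (-1) ^ Suc j * q ^ ((Suc j)\<^sup>2))"
    by simp
  moreover have "(1 - q ^ k) / (1 + q ^ k) = tanh (real k * (pi / (8 * s)))" for k
  proof -
    have "q ^ k = exp (- 2 * (real k * (pi / (8 * s))))"
      by (simp add: q_def flip: exp_of_nat_mult)
    then show ?thesis by (simp add: tanh_real_altdef)
  qed
  ultimately have "(\<lambda>n. (\<Prod>k=1..n. tanh (real k * (pi / (8 * s)))) / (2 * sqrt s))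
      \<longlonglongrightarrow> (1 + 2 * (\<Sum>j. (-1) ^ Suc j * q ^ ((Suc j)\<^sup>2))) / (2 * sqrt s)"
    using s by (intro tendsto_divide tendsto_const) auto
  then show ?thesis
    using gaussian_sum_odd_functional_equation[OF s] theta_o_eq_suminf[OF s] by (simp only: q_def)
qed

text \<open>The prefactors at \<open>r * s\<close> and \<open>r / s\<close> multiply to
  \<open>1 / (4 * r)\<close>, independently of \<open>s\<close>, so only the products of hyperbolic
  tangents need comparison.\<close>

theorem mainTheorem13:
  fixes r :: real
  assumes "r > 0"
  shows "\<forall>s>0. theta_o (r * s) * theta_o (r / s) \<le> theta_o r * theta_o r"
proof (intro allI impI)
  fix s :: real
  assume s: "s > 0"
  define T where "T x k = tanh (real k * (pi / (8 * x)))" for x :: real and k :: nat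
  define P where "P x n = (\<Prod>k=1..n. T x k) / (2 * sqrt x)" for x n
  have P: "P x \<longlonglongrightarrow> theta_o x" if "x > 0" for x
    using tanh_product_tendsto_theta_o[OF that] unfolding P_def T_def .
  show "theta_o (r * s) * theta_o (r / s) \<le> theta_o r * theta_o r"
  proof (rule LIMSEQ_le)
    show "(\<lambda>n. P (r * s) n * P (r / s) n) \<longlonglongrightarrow> theta_o (r * s) * theta_o (r / s)"
      using assms s by (intro tendsto_mult P) auto
    show "(\<lambda>n. P r n * P r n) \<longlonglongrightarrow> theta_o r * theta_o r"
      using assms by (intro tendsto_mult P) auto
    have "P (r * s) n * P (r / s) n \<le> P r n * P r n" for n
    proof -
      have T_nonneg: "T x k \<ge> 0" if "x > 0" for x k
        using that by (simp add: T_def)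
      have "(\<Prod>k=1..n. T (r * s) k) * (\<Prod>k=1..n. T (r / s) k) = (\<Prod>k=1..n. T (r * s) k * T (r / s) k)"
        by (simp add: prod.distrib)
      also have "\<dots> \<le> (\<Prod>k=1..n. (T r k)\<^sup>2)"
      proof (intro prod_mono conjI)
        fix k
        show "0 \<le> T (r * s) k * T (r / s) k" using assms s by (simp add: T_nonneg)
        show "T (r * s) k * T (r / s) k \<le> (T r k)\<^sup>2"
          unfolding T_def
        proof (rule tanh_mult_le_tanh_geometric_mean)
          \<comment> \<open>The argument at \<open>r\<close> is the geometric mean of those at
            \<open>r * s\<close> and \<open>r / s\<close>.\<close>
          show "(real k * (pi / (8 * r)))\<^sup>2 = real k * (pi / (8 * (r * s))) * (real k * (pi / (8 * (r / s))))"
            using assms s by (simp add: power2_eq_square)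
        qed
      qed
      also have "\<dots> = (\<Prod>k=1..n. T r k) * (\<Prod>k=1..n. T r k)"
        by (simp add: power2_eq_square prod.distrib)
      finally have "((\<Prod>k=1..n. T (r * s) k) * (\<Prod>k=1..n. T (r / s) k)) / (4 * r)
          \<le> ((\<Prod>k=1..n. T r k) * (\<Prod>k=1..n. T r k)) / (4 * r)"
        using assms by (intro divide_right_mono) auto
      moreover have "sqrt (r * s) * sqrt (r / s) = r" "sqrt r * sqrt r = r"
        using assms s by (auto simp flip: real_sqrt_mult)
      ultimately show ?thesis
        by (simp add: P_def times_divide_times_eq)
    qed
    then show "\<exists>N. \<forall>n\<ge>N. P (r * s) n * P (r / s) n \<le> P r n * P r n" by blast
  qed
qed

end
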